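(* ($\ell_2$-type entropy.) Let $n\in\mathbb N\cup\{0\}$ and let $X:=\ell_2$ (real) with the norm $\|(x_i)_{i=1}^\infty\|:=\sum_{i=1}^{2n}|x_i|+\sqrt{\sum_{i=2n+1}^\infty x_i^2}$ (the first sum being $0$ if $n=0$). For each $x\in X$ let $$b(x):=\sum_{i=1}^\infty\left(e^{(x_{2i-1}+x_{2i})^2}+e^{(x_{2i-1}-x_{2i})^2}-2\right).$$ Then $b:X\to\mathbb R$ is well defined and is a sequentially consistent Bregman function with zone $X$ which satisfies the limiting difference property, and for all $y\in X$ and $\gamma\in\mathbb R$ the second type level-set $\{x\in X:B(x,y)\le\gamma\}$ is bounded. Moreover, $b$ is strongly convex on $X$ with strong convexity parameter $1/n$ if $n>0$ and $4$ if $n=0$.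
   Context: For convex $b:X\to\mathbb R$, $b$ is strongly convex on $X$ with strong convexity parameter $\mu>0$ if $b(\lambda x+(1-\lambda)y)+\frac12\mu\lambda(1-\lambda)\|x-y\|^2\le\lambda b(x)+(1-\lambda)b(y)$ for all $\lambda\in(0,1)$, $x,y\in X$. Divergence: $B(x,y):=b(x)-b(y)-\langle b'(y),x-y\rangle$ for $x,y\in X$, where $b'(y)\in X^*$ is the Gâteaux derivative. A function $b:X\to\mathbb R$ (so $\mathrm{dom}(b)=X$) is a Bregman function with zone $X$ if: (i) $b$ is Gâteaux differentiable on $X$; (ii) $b$ is strictly convex and lower semicontinuous on $X$; (iii) for each $\gamma\in\mathbb R$ and $x\in X$ the set $\{y\in X:B(x,y)\le\gamma\}$ is bounded; (iv) if $\|x-y_i\|\to0$, then $B(x,y_i)\to0$; (v) if $(x_i)$ is a bounded sequence in $X$, $B(x_i,y_i)\to0$ and $\|y_i-y\|\to0$ for some $y\in X$, then $\|x_i-y\|\to0$. $b$ has the limiting difference property if for each $x\in X$ and each sequence $(y_i)$ in $X$ converging weakly to some $y\in X$, $B(x,y)=\lim_{i\to\infty}(B(x,y_i)-B(y,y_i))$. $b$ is sequentially consistent if for all sequences $(x_i),(y_i)$ in $X$ with $(y_i)$ bounded and $B(x_i,y_i)\to0$ one has $\|x_i-y_i\|\to0$. *)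

theory Defs
  imports "HOL-Analysis.Analysis"
begin

section \<open>Bregman functions on a normed space\<close>

text \<open>
  The norm is an explicit argument \<open>nrm\<close> on a real vector space instead of a
  \<^class>\<open>real_normed_vector\<close> instance, because the space studied below carries a family of
  norms indexed by a natural number. All functions are total and real-valued, so
  \<open>dom(b) = X\<close> is built into the type of \<open>b\<close>.
\<close>

definition is_norm :: "('a::real_vector \<Rightarrow> real) \<Rightarrow> bool" where
  "is_norm nrm \<longleftrightarrow>
     (\<forall>x. nrm x = 0 \<longleftrightarrow> x = 0) \<and>
     (\<forall>x y. nrm (x + y) \<le> nrm x + nrm y) \<and>
     (\<forall>r x. nrm (r *\<^sub>R x) = \<bar>r\<bar> * nrm x)"

definition norm_bounded :: "('a \<Rightarrow> real) \<Rightarrow> 'a set \<Rightarrow> bool" where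
  "norm_bounded nrm S \<longleftrightarrow> (\<exists>C. \<forall>x\<in>S. nrm x \<le> C)"

definition dual_space :: "('a::real_vector \<Rightarrow> real) \<Rightarrow> ('a \<Rightarrow> real) set" where
  "dual_space nrm = {f. linear f \<and> (\<exists>K. \<forall>x. \<bar>f x\<bar> \<le> K * nrm x)}"

definition norm_tendsto :: "('a::real_vector \<Rightarrow> real) \<Rightarrow> (nat \<Rightarrow> 'a) \<Rightarrow> 'a \<Rightarrow> bool" where
  "norm_tendsto nrm xs x \<longleftrightarrow> (\<lambda>i. nrm (xs i - x)) \<longlonglongrightarrow> 0"

definition weakly_tendsto :: "('a::real_vector \<Rightarrow> real) \<Rightarrow> (nat \<Rightarrow> 'a) \<Rightarrow> 'a \<Rightarrow> bool" where
  "weakly_tendsto nrm xs x \<longleftrightarrow> (\<forall>f\<in>dual_space nrm. (\<lambda>i. f (xs i)) \<longlonglongrightarrow> f x)"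

definition lower_semicont :: "('a::real_vector \<Rightarrow> real) \<Rightarrow> ('a \<Rightarrow> real) \<Rightarrow> bool" where
  "lower_semicont nrm b \<longleftrightarrow>
     (\<forall>x. \<forall>\<epsilon>>0. \<exists>\<delta>>0. \<forall>y. nrm (y - x) < \<delta> \<longrightarrow> b x - \<epsilon> < b y)"

definition strictly_convex :: "('a::real_vector \<Rightarrow> real) \<Rightarrow> bool" where
  "strictly_convex b \<longleftrightarrow>
     (\<forall>x y. \<forall>t\<in>{0<..<1}. x \<noteq> y \<longrightarrow>
        b (t *\<^sub>R x + (1 - t) *\<^sub>R y) < t * b x + (1 - t) * b y)"

definition strongly_convex ::
  "('a::real_vector \<Rightarrow> real) \<Rightarrow> ('a \<Rightarrow> real) \<Rightarrow> real \<Rightarrow> bool" where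
  "strongly_convex nrm b \<mu> \<longleftrightarrow> convex_on UNIV b \<and> \<mu> > 0 \<and>
     (\<forall>x y. \<forall>t\<in>{0<..<1}.
        b (t *\<^sub>R x + (1 - t) *\<^sub>R y) + 1/2 * \<mu> * t * (1 - t) * (nrm (x - y))\<^sup>2
          \<le> t * b x + (1 - t) * b y)"

definition has_gateaux_derivative ::
  "('a::real_vector \<Rightarrow> real) \<Rightarrow> ('a \<Rightarrow> real) \<Rightarrow> ('a \<Rightarrow> real) \<Rightarrow> 'a \<Rightarrow> bool" where
  "has_gateaux_derivative nrm b g y \<longleftrightarrow> g \<in> dual_space nrm \<and>
     (\<forall>h. ((\<lambda>t. b (y + t *\<^sub>R h)) has_real_derivative g h) (at 0))"

lemma has_gateaux_derivative_unique:
  assumes "has_gateaux_derivative nrm b f y" "has_gateaux_derivative nrm b g y"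
  shows "f = g"
  using assms unfolding has_gateaux_derivative_def by (metis DERIV_unique ext)

definition gateaux_derivative ::
  "('a::real_vector \<Rightarrow> real) \<Rightarrow> ('a \<Rightarrow> real) \<Rightarrow> 'a \<Rightarrow> 'a \<Rightarrow> real" where
  "gateaux_derivative nrm b y = (THE g. has_gateaux_derivative nrm b g y)"

definition gateaux_differentiable :: "('a::real_vector \<Rightarrow> real) \<Rightarrow> ('a \<Rightarrow> real) \<Rightarrow> bool" where
  "gateaux_differentiable nrm b \<longleftrightarrow> (\<forall>y. \<exists>g. has_gateaux_derivative nrm b g y)"

definition bregman_div ::
  "('a::real_vector \<Rightarrow> real) \<Rightarrow> ('a \<Rightarrow> real) \<Rightarrow> 'a \<Rightarrow> 'a \<Rightarrow> real" where
  "bregman_div nrm b x y = b x - b y - gateaux_derivative nrm b y (x - y)"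

definition bregman_function :: "('a::real_vector \<Rightarrow> real) \<Rightarrow> ('a \<Rightarrow> real) \<Rightarrow> bool" where
  "bregman_function nrm b \<longleftrightarrow>
     gateaux_differentiable nrm b \<and>
     strictly_convex b \<and> lower_semicont nrm b \<and>
     (\<forall>\<gamma> x. norm_bounded nrm {y. bregman_div nrm b x y \<le> \<gamma>}) \<and>
     (\<forall>x ys. norm_tendsto nrm ys x \<longrightarrow> (\<lambda>i. bregman_div nrm b x (ys i)) \<longlonglongrightarrow> 0) \<and>
     (\<forall>xs ys y. norm_bounded nrm (range xs) \<and>
        (\<lambda>i. bregman_div nrm b (xs i) (ys i)) \<longlonglongrightarrow> 0 \<and> norm_tendsto nrm ys y
        \<longrightarrow> norm_tendsto nrm xs y)"

definition limiting_difference :: "('a::real_vector \<Rightarrow> real) \<Rightarrow> ('a \<Rightarrow> real) \<Rightarrow> bool" where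
  "limiting_difference nrm b \<longleftrightarrow>
     (\<forall>x ys y. weakly_tendsto nrm ys y \<longrightarrow>
        (\<lambda>i. bregman_div nrm b x (ys i) - bregman_div nrm b y (ys i))
          \<longlonglongrightarrow> bregman_div nrm b x y)"

definition sequentially_consistent :: "('a::real_vector \<Rightarrow> real) \<Rightarrow> ('a \<Rightarrow> real) \<Rightarrow> bool" where
  "sequentially_consistent nrm b \<longleftrightarrow>
     (\<forall>xs ys. norm_bounded nrm (range ys) \<and>
        (\<lambda>i. bregman_div nrm b (xs i) (ys i)) \<longlonglongrightarrow> 0
        \<longrightarrow> (\<lambda>i. nrm (xs i - ys i)) \<longlonglongrightarrow> 0)"


section \<open>The real sequence space\<close>

typedef ell2 = "{x :: nat \<Rightarrow> real. summable (\<lambda>i. (x i)\<^sup>2)}"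
  morphisms coord Ell2
  by (rule exI[of _ "\<lambda>_. 0"]) simp

setup_lifting type_definition_ell2

lemma summable_coord: "summable (\<lambda>i. (coord x i)\<^sup>2)"
  using coord[of x] by simp

lemma square_summable_add:
  fixes x y :: "nat \<Rightarrow> real"
  assumes "summable (\<lambda>i. (x i)\<^sup>2)" "summable (\<lambda>i. (y i)\<^sup>2)"
  shows "summable (\<lambda>i. (x i + y i)\<^sup>2)"
proof (rule summable_comparison_test')
  show "summable (\<lambda>i. 2 * (x i)\<^sup>2 + 2 * (y i)\<^sup>2)"
    by (intro summable_add summable_mult assms)
  show "norm ((x i + y i)\<^sup>2) \<le> 2 * (x i)\<^sup>2 + 2 * (y i)\<^sup>2" for i
  proof -
    have "2 * (x i)\<^sup>2 + 2 * (y i)\<^sup>2 - (x i + y i)\<^sup>2 = (x i - y i)\<^sup>2"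
      by (simp add: power2_sum power2_diff)
    then have "(x i + y i)\<^sup>2 \<le> 2 * (x i)\<^sup>2 + 2 * (y i)\<^sup>2"
      by (smt (verit) zero_le_power2)
    then show ?thesis by simp
  qed
qed

instantiation ell2 :: real_vector
begin

lift_definition zero_ell2 :: ell2 is "\<lambda>_. 0" by simp
lift_definition uminus_ell2 :: "ell2 \<Rightarrow> ell2" is "\<lambda>x i. - x i" by simp
lift_definition plus_ell2 :: "ell2 \<Rightarrow> ell2 \<Rightarrow> ell2" is "\<lambda>x y i. x i + y i"
  by (rule square_summable_add)
lift_definition minus_ell2 :: "ell2 \<Rightarrow> ell2 \<Rightarrow> ell2" is "\<lambda>x y i. x i - y i"
  subgoal for x y using square_summable_add[of x "\<lambda>i. - y i"] by simp
  done
lift_definition scaleR_ell2 :: "real \<Rightarrow> ell2 \<Rightarrow> ell2" is "\<lambda>r x i. r * x i"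
  by (simp add: power_mult_distrib summable_mult)

instance
  by standard (transfer; simp add: algebra_simps fun_eq_iff)+

end

text \<open>Coordinates are counted from \<open>0\<close>: \<open>coord x i\<close> is the usual \<open>x\<^sub>i\<^sub>+\<^sub>1\<close>.\<close>

definition ell2_norm :: "nat \<Rightarrow> ell2 \<Rightarrow> real" where
  "ell2_norm n x = (\<Sum>i<2*n. \<bar>coord x i\<bar>) + sqrt (\<Sum>i. (coord x (2*n + i))\<^sup>2)"

lemma summable_tail: "summable (\<lambda>i. (coord x (k + i))\<^sup>2)"
  using summable_ignore_initial_segment[OF summable_coord[of x], of k]
  by (simp add: add.commute)

lemma is_norm_ell2_norm: "is_norm (ell2_norm n)"
  unfolding is_norm_def
proof (intro conjI allI)
  fix x y :: ell2 and r :: real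
  let ?t = "\<lambda>x i. coord x (2*n + i)"
  have nonneg: "0 \<le> (\<Sum>i<2*n. \<bar>coord x i\<bar>)" "0 \<le> sqrt (\<Sum>i. (?t x i)\<^sup>2)"
    by (auto intro!: sum_nonneg suminf_nonneg summable_tail)
  show "ell2_norm n x = 0 \<longleftrightarrow> x = 0"
  proof
    assume "ell2_norm n x = 0"
    then have head: "(\<Sum>i<2*n. \<bar>coord x i\<bar>) = 0" and "sqrt (\<Sum>i. (?t x i)\<^sup>2) = 0"
      using nonneg unfolding ell2_norm_def by linarith+
    then have tail: "(\<Sum>i. (?t x i)\<^sup>2) = 0"
      by simp
    have "coord x i = 0" for i
    proof (cases "i < 2*n")
      case True
      then show ?thesis using head by (subst (asm) sum_nonneg_eq_0_iff) auto
    next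
      case False
      have "\<forall>i. (?t x i)\<^sup>2 = 0"
        using tail suminf_eq_zero_iff[OF summable_tail[of x "2*n"]] by simp
      then show ?thesis using False
        by (metis le_add_diff_inverse not_less zero_eq_power2)
    qed
    then show "x = 0"
      by transfer auto
  qed (simp add: ell2_norm_def zero_ell2.rep_eq)
  show "ell2_norm n (r *\<^sub>R x) = \<bar>r\<bar> * ell2_norm n x"
    by (simp add: ell2_norm_def scaleR_ell2.rep_eq abs_mult sum_distrib_left
        power_mult_distrib suminf_mult summable_tail real_sqrt_mult distrib_left)
  have "sqrt (\<Sum>i. (?t (x + y) i)\<^sup>2) \<le> sqrt (\<Sum>i. (?t x i)\<^sup>2) + sqrt (\<Sum>i. (?t y i)\<^sup>2)"
  proof (rule LIMSEQ_le)
    show "(\<lambda>N. L2_set (?t (x + y)) {..<N}) \<longlonglongrightarrow> sqrt (\<Sum>i. (?t (x + y) i)\<^sup>2)"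
      unfolding L2_set_def by (intro tendsto_real_sqrt summable_LIMSEQ summable_tail)
    show "(\<lambda>N. L2_set (?t x) {..<N} + L2_set (?t y) {..<N})
        \<longlonglongrightarrow> sqrt (\<Sum>i. (?t x i)\<^sup>2) + sqrt (\<Sum>i. (?t y i)\<^sup>2)"
      unfolding L2_set_def
      by (intro tendsto_add tendsto_real_sqrt summable_LIMSEQ summable_tail)
    show "\<exists>N. \<forall>m\<ge>N. L2_set (?t (x + y)) {..<m} \<le> L2_set (?t x) {..<m} + L2_set (?t y) {..<m}"
      using L2_set_triangle_ineq[of "?t x" "?t y"] by (simp add: plus_ell2.rep_eq)
  qed
  moreover have "(\<Sum>i<2*n. \<bar>coord (x + y) i\<bar>) \<le> (\<Sum>i<2*n. \<bar>coord x i\<bar>) + (\<Sum>i<2*n. \<bar>coord y i\<bar>)"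
    unfolding sum.distrib[symmetric] by (rule sum_mono) (simp add: plus_ell2.rep_eq)
  ultimately show "ell2_norm n (x + y) \<le> ell2_norm n x + ell2_norm n y"
    by (simp add: ell2_norm_def)
qed

definition entropy_term :: "ell2 \<Rightarrow> nat \<Rightarrow> real" where
  "entropy_term x i =
     exp ((coord x (2*i) + coord x (2*i + 1))\<^sup>2) + exp ((coord x (2*i) - coord x (2*i + 1))\<^sup>2) - 2"

definition ell2_entropy :: "ell2 \<Rightarrow> real" where
  "ell2_entropy x = (\<Sum>i. entropy_term x i)"

end

theory Submission
  imports Defs
begin

text \<open>
  Everything reduces to one two-sided quadratic estimate. In the coordinates
  \<open>u = x\<^sub>2\<^sub>i + x\<^sub>2\<^sub>i\<^sub>+\<^sub>1\<close>, \<open>v = x\<^sub>2\<^sub>i - x\<^sub>2\<^sub>i\<^sub>+\<^sub>1\<close> (the map \<open>hadamard\<close>, which is \<open>sqrt 2\<close> times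
  an isometry of the Hilbert space), the entropy becomes the separable functional
  \<open>energy z = \<Sum>j. \<phi>(z\<^sub>j)\<close> with \<open>\<phi> t = exp (t\<^sup>2) - 1\<close>. Since \<open>\<phi>'' t / 2 = (1 + 2 t\<^sup>2) exp (t\<^sup>2)\<close> is
  at least \<open>1\<close> everywhere and bounded on bounded sets, Taylor's formula in each coordinate gives,
  with \<open>D\<close> the divergence of \<open>energy\<close> and \<open>K\<close> depending on a bound \<open>M\<close> of both points,
  \<open>\<parallel>w - z\<parallel>\<^sup>2 \<le> D(w, z) \<le> K \<parallel>w - z\<parallel>\<^sup>2\<close>
  (\<open>energy_divergence_ge\<close>, \<open>energy_divergence_le\<close>).

  The upper estimate yields Frechet differentiability, hence the Gateaux derivative and lower
  semicontinuity, and condition (iv) of a Bregman function. The lower one, which reads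
  \<open>2 \<parallel>x - y\<parallel>\<^sup>2 \<le> B(x, y)\<close> for the entropy, yields boundedness of both kinds of level sets, condition
  (v), sequential consistency, and strict and strong convexity. Except for strong convexity these
  notions see at most the convergent sequences and bounded sets of the norm, so that the equivalence
  of the given norm with the Hilbert norm suffices. For strong convexity, Cauchy-Schwarz bounds the
  square of the given norm by \<open>(2 n + 1) \<parallel>x\<parallel>\<^sup>2\<close>, and the parameter comes from
  \<open>(2 n + 1) / n \<le> 4\<close> for \<open>n > 0\<close>.

  In the limiting difference property all terms cancel except \<open>b'(y\<^sub>i)(x - y)\<close>, so it asks for
  convergence of the derivatives at each vector. A weakly convergent sequence is bounded (uniform
  boundedness) and converges coordinatewise. The gradient acts coordinate by coordinate and maps
  bounded sets to bounded sets, so it preserves both properties, and together they imply weak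
  convergence.
\<close>

section \<open>The Hilbert space structure\<close>

lemmas coord_simps = zero_ell2.rep_eq uminus_ell2.rep_eq plus_ell2.rep_eq minus_ell2.rep_eq
  scaleR_ell2.rep_eq

lemma ell2_eqI: "(\<And>i. coord x i = coord y i) \<Longrightarrow> x = y"
  by (metis coord_inject ext)

lemma summable_coord_mult: "summable (\<lambda>i. coord x i * coord y i)"
proof (rule summable_comparison_test')
  show "summable (\<lambda>i. (coord x i)\<^sup>2 + (coord y i)\<^sup>2)"
    by (intro summable_add summable_coord)
  show "norm (coord x i * coord y i) \<le> (coord x i)\<^sup>2 + (coord y i)\<^sup>2" for i
  proof -
    have "2 * (\<bar>coord x i\<bar> * \<bar>coord y i\<bar>) \<le> (coord x i)\<^sup>2 + (coord y i)\<^sup>2"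
      using sum_squares_bound[of "\<bar>coord x i\<bar>" "\<bar>coord y i\<bar>"] by simp
    moreover have "0 \<le> \<bar>coord x i\<bar> * \<bar>coord y i\<bar>"
      by simp
    ultimately show ?thesis
      unfolding real_norm_def abs_mult by linarith
  qed
qed

text \<open>
  The usual \<open>\<ell>\<^sub>2\<close> norm, that is \<open>ell2_norm 0\<close>, becomes the norm of the type: the estimates for the
  entropy are sharp and coordinatewise in this norm, and the norms \<open>ell2_norm n\<close> are compared with it
  afterwards.
\<close>
instantiation ell2 :: real_inner
begin

definition inner_ell2 :: "ell2 \<Rightarrow> ell2 \<Rightarrow> real" where
  "inner_ell2 x y = (\<Sum>i. coord x i * coord y i)"

definition norm_ell2 :: "ell2 \<Rightarrow> real" where
  "norm_ell2 x = sqrt (inner x x)"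

definition dist_ell2 :: "ell2 \<Rightarrow> ell2 \<Rightarrow> real" where
  "dist_ell2 x y = norm (x - y)"

definition sgn_ell2 :: "ell2 \<Rightarrow> ell2" where
  "sgn_ell2 x = x /\<^sub>R norm x"

definition uniformity_ell2 :: "(ell2 \<times> ell2) filter" where
  "uniformity_ell2 = (INF e\<in>{0 <..}. principal {(x, y). dist x y < e})"

definition open_ell2 :: "ell2 set \<Rightarrow> bool" where
  "open_ell2 S = (\<forall>x\<in>S. \<forall>\<^sub>F (x', y) in uniformity. x' = x \<longrightarrow> y \<in> S)"

instance
proof
  fix x y z :: ell2 and r :: real
  show "x \<bullet> y = y \<bullet> x"
    by (simp add: inner_ell2_def mult.commute)
  show "(x + y) \<bullet> z = x \<bullet> z + y \<bullet> z"
    by (simp add: inner_ell2_def coord_simps distrib_right suminf_add summable_coord_mult)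
  show "(r *\<^sub>R x) \<bullet> y = r * (x \<bullet> y)"
    by (simp add: inner_ell2_def coord_simps mult.assoc suminf_mult summable_coord_mult)
  show "0 \<le> x \<bullet> x"
    by (simp add: inner_ell2_def suminf_nonneg summable_coord_mult)
  show "x \<bullet> x = 0 \<longleftrightarrow> x = 0"
    using suminf_eq_zero_iff[OF summable_coord_mult[of x x]]
    by (auto simp: inner_ell2_def coord_simps intro!: ell2_eqI)
qed (rule norm_ell2_def dist_ell2_def sgn_ell2_def uniformity_ell2_def open_ell2_def)+

end

lemma norm_ell2_sums: "(\<lambda>i. (coord x i)\<^sup>2) sums (norm x)\<^sup>2"
  using summable_sums[OF summable_coord_mult[of x x]]
  unfolding power2_norm_eq_inner inner_ell2_def by (simp add: power2_eq_square)

lemma inner_ell2_sums: "(\<lambda>i. coord x i * coord y i) sums (x \<bullet> y)"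
  by (simp add: inner_ell2_def summable_sums summable_coord_mult)

lemma abs_coord_le: "\<bar>coord x i\<bar> \<le> norm (x :: ell2)"
proof -
  have "(\<Sum>j\<in>{i}. (coord x j)\<^sup>2) \<le> (norm x)\<^sup>2"
    unfolding sums_unique[OF norm_ell2_sums] by (rule sum_le_suminf[OF summable_coord]) auto
  then show ?thesis
    by (simp add: abs_le_square_iff[symmetric])
qed

instance ell2 :: complete_space
proof
  fix X :: "nat \<Rightarrow> ell2"
  assume X: "Cauchy X"
  have "Cauchy (\<lambda>n. coord (X n) i)" for i
  proof (rule metric_CauchyI)
    fix e :: real
    assume "e > 0"
    then obtain M where M: "\<forall>m\<ge>M. \<forall>n\<ge>M. norm (X m - X n) < e"
      using X unfolding Cauchy_iff by blast
    have "dist (coord (X m) i) (coord (X n) i) \<le> norm (X m - X n)" for m n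
      using abs_coord_le[of "X m - X n" i] by (simp add: dist_real_def coord_simps)
    with M show "\<exists>M. \<forall>m\<ge>M. \<forall>n\<ge>M. dist (coord (X m) i) (coord (X n) i) < e"
      by (meson le_less_trans)
  qed
  then have "\<exists>l. (\<lambda>n. coord (X n) i) \<longlonglongrightarrow> l" for i
    by (simp add: real_Cauchy_convergent flip: convergent_def)
  then obtain l where l: "\<And>i. (\<lambda>n. coord (X n) i) \<longlonglongrightarrow> l i"
    by metis
  \<comment> \<open>Passing to the limit in finite partial sums (Fatou) bounds the distance to the limit.\<close>
  have fatou: "summable (\<lambda>i. (coord (X m) i - l i)\<^sup>2) \<and> (\<Sum>i. (coord (X m) i - l i)\<^sup>2) \<le> e\<^sup>2"
    if M: "\<forall>n\<ge>M. norm (X m - X n) \<le> e" for e m M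
  proof -
    have "(\<Sum>i<N. (coord (X m) i - l i)\<^sup>2) \<le> e\<^sup>2" for N
    proof (rule LIMSEQ_le_const2)
      show "(\<lambda>n. \<Sum>i<N. (coord (X m) i - coord (X n) i)\<^sup>2) \<longlonglongrightarrow> (\<Sum>i<N. (coord (X m) i - l i)\<^sup>2)"
        by (intro tendsto_intros l)
      have "(\<Sum>i<N. (coord (X m) i - coord (X n) i)\<^sup>2) \<le> e\<^sup>2" if "n \<ge> M" for n
      proof -
        have "(\<Sum>i<N. (coord (X m - X n) i)\<^sup>2) \<le> (norm (X m - X n))\<^sup>2"
          unfolding sums_unique[OF norm_ell2_sums] by (rule sum_le_suminf[OF summable_coord]) auto
        also have "\<dots> \<le> e\<^sup>2"
          using M that by (intro power_mono) auto
        finally show ?thesis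
          by (simp add: coord_simps)
      qed
      then show "\<exists>M. \<forall>n\<ge>M. (\<Sum>i<N. (coord (X m) i - coord (X n) i)\<^sup>2) \<le> e\<^sup>2"
        by blast
    qed
    then show ?thesis
      by (auto intro!: summableI_nonneg_bounded suminf_le_const)
  qed
  obtain M1 where "\<forall>n\<ge>M1. norm (X M1 - X n) \<le> 1"
    using X unfolding Cauchy_iff by (meson less_imp_le order_refl zero_less_one)
  then have "summable (\<lambda>i. (coord (X M1) i - l i)\<^sup>2)"
    using fatou by blast
  from square_summable_add[OF this[unfolded power2_commute[of "coord _ _"]] summable_coord[of "X M1"]]
  have l_coord: "coord (Ell2 l) = l"
    by (simp add: Ell2_inverse)
  have "X \<longlonglongrightarrow> Ell2 l"
  proof (rule LIMSEQ_I)
    fix r :: real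
    assume "r > 0"
    then obtain M where M: "\<forall>m\<ge>M. \<forall>n\<ge>M. norm (X m - X n) < r/2"
      using X unfolding Cauchy_iff by (meson half_gt_zero)
    have "norm (X m - Ell2 l) < r" if "m \<ge> M" for m
    proof -
      have "(norm (X m - Ell2 l))\<^sup>2 = (\<Sum>i. (coord (X m) i - l i)\<^sup>2)"
        by (simp add: sums_unique[OF norm_ell2_sums] coord_simps l_coord)
      also have "\<dots> \<le> (r/2)\<^sup>2"
        using fatou[of M m "r/2"] M that by (simp add: less_imp_le)
      finally show ?thesis
        using \<open>r > 0\<close> abs_le_square_iff[of "norm (X m - Ell2 l)" "r/2"] by simp
    qed
    then show "\<exists>M. \<forall>m\<ge>M. norm (X m - Ell2 l) < r"
      by blast
  qed
  then show "convergent X"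
    by (rule convergentI)
qed

text \<open>
  Uniform boundedness principle. By Baire's theorem one of the closed sets of vectors on which the
  functionals are bounded by \<open>k\<close> contains a ball; moving from its centre by the radius in the
  direction of \<open>y\<^sub>i\<close> bounds the norm of \<open>y\<^sub>i\<close>.
\<close>
lemma pointwise_bounded_imp_bounded:
  fixes y :: "nat \<Rightarrow> 'a :: {real_inner, complete_space}"
  assumes "\<And>h. Bseq (\<lambda>i. y i \<bullet> h)"
  shows "bounded (range y)"
proof -
  define F where "F k = {h. \<forall>i. \<bar>y i \<bullet> h\<bar> \<le> real k}" for k
  have closed: "closed (F k)" for k
    unfolding F_def by (intro closed_Collect_all closed_Collect_le continuous_intros)
  have cover: "\<Union>(range F) = UNIV"
  proof -
    have "\<exists>k. h \<in> F k" for h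
    proof -
      obtain K where "\<And>i. \<bar>y i \<bullet> h\<bar> \<le> K"
        using assms[of h] by (auto simp: Bseq_def)
      moreover obtain k where "K \<le> real k"
        using real_arch_simple by blast
      ultimately show ?thesis
        unfolding F_def by (auto intro: order_trans)
    qed
    then show ?thesis by blast
  qed
  have "\<exists>k. interior (F k) \<noteq> {}"
  proof (rule ccontr)
    assume "\<not> (\<exists>k. interior (F k) \<noteq> {})"
    then have "euclidean interior_of \<Union>(range F) = {}"
      by (intro Baire_category_alt) (auto simp: completely_metrizable_space_euclidean closed)
    then show False
      by (simp add: cover)
  qed
  then obtain k x r where r: "r > 0" "cball x r \<subseteq> F k"
    by (metis all_not_in_conv mem_interior_cball)
  have "norm (y i) \<le> 2 * real k / r" for i
  proof -
    define z where "z = r *\<^sub>R sgn (y i)"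
    have "norm z \<le> r"
      using r by (simp add: z_def norm_sgn)
    then have "x \<in> F k" "x + z \<in> F k"
      using r by (auto simp: subset_iff dist_norm)
    then have "\<bar>y i \<bullet> x\<bar> \<le> real k" "\<bar>y i \<bullet> (x + z)\<bar> \<le> real k"
      by (auto simp: F_def)
    then have "y i \<bullet> z \<le> 2 * real k"
      by (simp add: inner_add_right)
    moreover have "y i \<bullet> z = r * norm (y i)"
      by (cases "y i = 0") (simp_all add: z_def sgn_div_norm dot_square_norm power2_eq_square)
    ultimately show ?thesis
      using r by (simp add: field_simps)
  qed
  then show ?thesis
    by (auto simp: bounded_iff)
qed

lift_definition truncate :: "nat \<Rightarrow> ell2 \<Rightarrow> ell2" is "\<lambda>N x i. if i < N then x i else 0"
  subgoal for N x
    by (rule summable_finite[of "{..<N}"]) auto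
  done

lemma inner_truncate: "x \<bullet> truncate N h = (\<Sum>j<N. coord x j * coord h j)"
  unfolding sums_unique[OF inner_ell2_sums]
  by (subst suminf_finite[of "{..<N}"]) (auto simp: truncate.rep_eq)

lemma truncate_tendsto: "(\<lambda>N. truncate N h) \<longlonglongrightarrow> h"
proof -
  have "(norm (truncate N h - h))\<^sup>2 = (norm h)\<^sup>2 - (\<Sum>j<N. (coord h j)\<^sup>2)" for N
  proof -
    have "truncate N h \<bullet> truncate N h = (\<Sum>j<N. (coord h j)\<^sup>2)"
      unfolding inner_truncate by (auto simp: truncate.rep_eq power2_eq_square)
    moreover have "h \<bullet> truncate N h = (\<Sum>j<N. (coord h j)\<^sup>2)"
      unfolding inner_truncate by (auto simp: power2_eq_square)
    ultimately show ?thesis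
      by (simp add: power2_norm_eq_inner inner_diff inner_commute)
  qed
  moreover have "(\<lambda>N. (norm h)\<^sup>2 - (\<Sum>j<N. (coord h j)\<^sup>2)) \<longlonglongrightarrow> (norm h)\<^sup>2 - (norm h)\<^sup>2"
    using norm_ell2_sums unfolding sums_def by (intro tendsto_intros)
  ultimately have "(\<lambda>N. (norm (truncate N h - h))\<^sup>2) \<longlonglongrightarrow> 0"
    by simp
  then have "(\<lambda>N. norm (truncate N h - h)) \<longlonglongrightarrow> 0"
    using tendsto_real_sqrt by fastforce
  then show ?thesis
    by (simp add: LIM_zero_iff tendsto_norm_zero_iff)
qed

text \<open>
  Against a truncated \<open>h\<close> the inner product is a finite sum of convergent terms; boundedness of the
  sequence makes the truncation error small uniformly in \<open>i\<close>, so the two limits may be swapped.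
\<close>
lemma inner_tendsto_of_coordinatewise:
  fixes l h :: ell2
  assumes "bounded (range g)" and coord: "\<And>j. (\<lambda>i. coord (g i) j) \<longlonglongrightarrow> coord l j"
  shows "(\<lambda>i. g i \<bullet> h) \<longlonglongrightarrow> l \<bullet> h"
proof (rule swap_uniform_limit')
  show "\<forall>\<^sub>F N in sequentially. (\<lambda>i. g i \<bullet> truncate N h) \<longlonglongrightarrow> l \<bullet> truncate N h"
    unfolding inner_truncate by (intro always_eventually allI tendsto_intros coord)
  show "(\<lambda>N. l \<bullet> truncate N h) \<longlonglongrightarrow> l \<bullet> h"
    by (intro tendsto_intros truncate_tendsto)
  show "uniform_limit UNIV (\<lambda>N i. g i \<bullet> truncate N h) (\<lambda>i. g i \<bullet> h) sequentially"
  proof (rule uniform_limitI)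
    fix e :: real
    assume "e > 0"
    obtain C where C: "C > 0" "\<And>i. norm (g i) \<le> C"
      using assms(1) by (auto simp: bounded_pos)
    have "\<forall>\<^sub>F N in sequentially. dist (truncate N h) h < e / C"
      using truncate_tendsto C \<open>e > 0\<close> by (intro tendstoD) auto
    then show "\<forall>\<^sub>F N in sequentially. \<forall>i\<in>UNIV. dist (g i \<bullet> truncate N h) (g i \<bullet> h) < e"
    proof eventually_elim
      case (elim N)
      show ?case
      proof
        fix i
        have "dist (g i \<bullet> truncate N h) (g i \<bullet> h) = \<bar>g i \<bullet> (truncate N h - h)\<bar>"
          by (simp add: dist_real_def inner_diff_right)
        also have "\<dots> \<le> norm (g i) * norm (truncate N h - h)"
          by (rule Cauchy_Schwarz_ineq2)
        also have "\<dots> \<le> C * norm (truncate N h - h)"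
          using C by (intro mult_right_mono) auto
        also have "\<dots> < e"
          using elim C by (simp add: dist_norm field_simps)
        finally show "dist (g i \<bullet> truncate N h) (g i \<bullet> h) < e" .
      qed
    qed
  qed
qed auto

section \<open>The separable functional\<close>

text \<open>The factor on the right is half the second derivative of \<open>exp (t\<^sup>2)\<close> at \<open>\<xi>\<close>.\<close>
lemma exp_square_taylor:
  fixes s t :: real
  shows "\<exists>\<xi>. \<bar>\<xi>\<bar> \<le> max \<bar>s\<bar> \<bar>t\<bar> \<and>
    exp (t\<^sup>2) - exp (s\<^sup>2) - 2 * s * exp (s\<^sup>2) * (t - s) = (1 + 2 * \<xi>\<^sup>2) * exp (\<xi>\<^sup>2) * (t - s)\<^sup>2"
proof (cases "t = s")
  case True
  then show ?thesis
    by (intro exI[of _ s]) auto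
next
  case False
  define diff :: "nat \<Rightarrow> real \<Rightarrow> real" where
    "diff m x = (if m = 0 then exp (x\<^sup>2) else if m = 1 then 2 * x * exp (x\<^sup>2)
       else (2 + 4 * x\<^sup>2) * exp (x\<^sup>2))" for m x
  have deriv: "DERIV (diff m) x :> diff (Suc m) x" if "m < 2" for m x
  proof -
    have "((\<lambda>x. exp (x\<^sup>2)) has_real_derivative 2 * x * exp (x\<^sup>2)) (at x)"
      by (auto intro!: derivative_eq_intros)
    moreover have "((\<lambda>x. 2 * x * exp (x\<^sup>2)) has_real_derivative (2 + 4 * x\<^sup>2) * exp (x\<^sup>2)) (at x)"
      by (auto intro!: derivative_eq_intros simp: algebra_simps power2_eq_square)
    moreover from that have "m = 0 \<or> m = 1"
      by auto
    ultimately show ?thesis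
      by (auto simp: diff_def[abs_def])
  qed
  have "\<exists>\<xi>. (if t < s then t < \<xi> \<and> \<xi> < s else s < \<xi> \<and> \<xi> < t) \<and>
      exp (t\<^sup>2) = (\<Sum>m<2. (diff m s / fact m) * (t - s) ^ m) + (diff 2 \<xi> / fact 2) * (t - s)\<^sup>2"
    by (rule Taylor[where a = "min s t" and b = "max s t"]) (use deriv False in \<open>auto simp: diff_def[abs_def]\<close>)
  then obtain \<xi> where "if t < s then t < \<xi> \<and> \<xi> < s else s < \<xi> \<and> \<xi> < t"
    and "exp (t\<^sup>2) = exp (s\<^sup>2) + 2 * s * exp (s\<^sup>2) * (t - s) + (1 + 2 * \<xi>\<^sup>2) * exp (\<xi>\<^sup>2) * (t - s)\<^sup>2"
    by (auto simp: diff_def numeral_2_eq_2 field_simps)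
  then show ?thesis
    by (intro exI[of _ \<xi>]) (auto split: if_splits)
qed

lemma exp_square_divergence_ge:
  fixes s t :: real
  shows "(t - s)\<^sup>2 \<le> exp (t\<^sup>2) - exp (s\<^sup>2) - 2 * s * exp (s\<^sup>2) * (t - s)"
proof -
  obtain \<xi> where \<xi>: "exp (t\<^sup>2) - exp (s\<^sup>2) - 2 * s * exp (s\<^sup>2) * (t - s)
      = (1 + 2 * \<xi>\<^sup>2) * exp (\<xi>\<^sup>2) * (t - s)\<^sup>2"
    using exp_square_taylor by blast
  have "1 * 1 \<le> (1 + 2 * \<xi>\<^sup>2) * exp (\<xi>\<^sup>2)"
    by (intro mult_mono) auto
  from mult_right_mono[OF this, of "(t - s)\<^sup>2"] show ?thesis
    unfolding \<xi> by simp
qed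

lemma exp_square_divergence_le:
  fixes s t M :: real
  assumes "\<bar>s\<bar> \<le> M" "\<bar>t\<bar> \<le> M"
  shows "exp (t\<^sup>2) - exp (s\<^sup>2) - 2 * s * exp (s\<^sup>2) * (t - s)
    \<le> (1 + 2 * M\<^sup>2) * exp (M\<^sup>2) * (t - s)\<^sup>2"
proof -
  obtain \<xi> where "\<bar>\<xi>\<bar> \<le> max \<bar>s\<bar> \<bar>t\<bar>" and \<xi>: "exp (t\<^sup>2) - exp (s\<^sup>2) - 2 * s * exp (s\<^sup>2) * (t - s)
      = (1 + 2 * \<xi>\<^sup>2) * exp (\<xi>\<^sup>2) * (t - s)\<^sup>2"
    using exp_square_taylor by blast
  then have "\<xi>\<^sup>2 \<le> M\<^sup>2"
    using assms by (intro abs_le_square_iff[THEN iffD1]) auto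
  then show ?thesis
    unfolding \<xi> by (intro mult_right_mono mult_mono) auto
qed

text \<open>The entropy after the change of coordinates by which the pairs decouple.\<close>
definition energy :: "ell2 \<Rightarrow> real" where
  "energy z = (\<Sum>j. exp ((coord z j)\<^sup>2) - 1)"

lemma energy_sums: "(\<lambda>j. exp ((coord z j)\<^sup>2) - 1) sums energy z"
proof -
  have "summable (\<lambda>j. exp ((coord z j)\<^sup>2) - 1)"
  proof (rule summable_comparison_test')
    show "summable (\<lambda>j. (1 + 2 * (norm z)\<^sup>2) * exp ((norm z)\<^sup>2) * (coord z j)\<^sup>2)"
      by (intro summable_mult summable_coord)
    show "norm (exp ((coord z j)\<^sup>2) - 1) \<le> (1 + 2 * (norm z)\<^sup>2) * exp ((norm z)\<^sup>2) * (coord z j)\<^sup>2" for j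
      using exp_square_divergence_le[of 0 "norm z" "coord z j"] abs_coord_le[of z j] by simp
  qed
  then show ?thesis
    by (simp add: energy_def summable_sums)
qed

lift_definition energy_grad :: "ell2 \<Rightarrow> ell2" is "\<lambda>z j. 2 * z j * exp ((z j)\<^sup>2)"
proof -
  fix z :: "nat \<Rightarrow> real"
  assume z: "summable (\<lambda>j. (z j)\<^sup>2)"
  show "summable (\<lambda>j. (2 * z j * exp ((z j)\<^sup>2))\<^sup>2)"
  proof (rule summable_comparison_test')
    show "summable (\<lambda>j. (2 * exp (\<Sum>j. (z j)\<^sup>2))\<^sup>2 * (z j)\<^sup>2)"
      by (intro summable_mult z)
    fix j
    have "(z j)\<^sup>2 \<le> (\<Sum>j. (z j)\<^sup>2)"
      using sum_le_suminf[OF z, of "{j}"] by simp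
    then have "(2 * exp ((z j)\<^sup>2))\<^sup>2 * (z j)\<^sup>2 \<le> (2 * exp (\<Sum>j. (z j)\<^sup>2))\<^sup>2 * (z j)\<^sup>2"
      by (intro mult_right_mono power_mono) auto
    then show "norm ((2 * z j * exp ((z j)\<^sup>2))\<^sup>2) \<le> (2 * exp (\<Sum>j. (z j)\<^sup>2))\<^sup>2 * (z j)\<^sup>2"
      by (simp add: power_mult_distrib mult_ac)
  qed
qed

lemma norm_energy_grad_le: "norm (energy_grad z) \<le> 2 * exp ((norm z)\<^sup>2) * norm z"
proof (rule power2_le_imp_le)
  show "(norm (energy_grad z))\<^sup>2 \<le> (2 * exp ((norm z)\<^sup>2) * norm z)\<^sup>2"
    unfolding power_mult_distrib[of _ "norm z"]
  proof (rule sums_le[OF _ norm_ell2_sums sums_mult[OF norm_ell2_sums]])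
    fix j
    have "(coord z j)\<^sup>2 \<le> (norm z)\<^sup>2"
      using abs_coord_le[of z j] by (intro abs_le_square_iff[THEN iffD1]) auto
    then have "(2 * exp ((coord z j)\<^sup>2))\<^sup>2 * (coord z j)\<^sup>2 \<le> (2 * exp ((norm z)\<^sup>2))\<^sup>2 * (coord z j)\<^sup>2"
      by (intro mult_right_mono power_mono) auto
    then show "(coord (energy_grad z) j)\<^sup>2 \<le> (2 * exp ((norm z)\<^sup>2))\<^sup>2 * (coord z j)\<^sup>2"
      by (simp add: energy_grad.rep_eq power_mult_distrib mult_ac)
  qed
qed auto

text \<open>
  The divergence is the sum of the one-dimensional divergences, so scalar estimates that are
  quadratic in \<open>coord (w - z) j\<close> become estimates by the squared norm.
\<close>
lemma energy_divergence_sums: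
  "(\<lambda>j. exp ((coord w j)\<^sup>2) - exp ((coord z j)\<^sup>2)
        - 2 * coord z j * exp ((coord z j)\<^sup>2) * (coord w j - coord z j))
     sums (energy w - energy z - energy_grad z \<bullet> (w - z))"
  using sums_diff[OF sums_diff[OF energy_sums[of w] energy_sums[of z]]
      inner_ell2_sums[of "energy_grad z" "w - z"]]
  by (simp add: energy_grad.rep_eq coord_simps)

lemma energy_divergence_ge: "(norm (w - z))\<^sup>2 \<le> energy w - energy z - energy_grad z \<bullet> (w - z)"
  by (rule sums_le[OF _ norm_ell2_sums energy_divergence_sums])
    (simp add: coord_simps exp_square_divergence_ge)

lemma energy_divergence_le:
  assumes "norm w \<le> M" "norm z \<le> M"
  shows "energy w - energy z - energy_grad z \<bullet> (w - z)
    \<le> (1 + 2 * M\<^sup>2) * exp (M\<^sup>2) * (norm (w - z))\<^sup>2"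
proof (rule sums_le[OF _ energy_divergence_sums sums_mult[OF norm_ell2_sums]])
  fix j
  show "exp ((coord w j)\<^sup>2) - exp ((coord z j)\<^sup>2)
      - 2 * coord z j * exp ((coord z j)\<^sup>2) * (coord w j - coord z j)
    \<le> (1 + 2 * M\<^sup>2) * exp (M\<^sup>2) * (coord (w - z) j)\<^sup>2"
    unfolding coord_simps
    using assms abs_coord_le[of w j] abs_coord_le[of z j]
    by (intro exp_square_divergence_le) linarith+
qed

lemma energy_has_derivative: "(energy has_derivative (\<lambda>h. energy_grad z \<bullet> h)) (at z)"
proof (rule has_derivativeI_sandwich[where e = 1])
  define M where "M = norm z + 1"
  define K where "K = (1 + 2 * M\<^sup>2) * exp (M\<^sup>2)"
  show "bounded_linear (\<lambda>h. energy_grad z \<bullet> h)"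
    by (rule bounded_linear_inner_right)
  show "((\<lambda>w. K * norm (w - z)) \<longlongrightarrow> 0) (at z)"
    by (auto intro!: tendsto_eq_intros)
  fix w
  assume w: "w \<noteq> z" "dist w z < 1"
  have "norm w \<le> M" "norm z \<le> M"
    using w norm_triangle_sub[of w z] by (auto simp: M_def dist_norm)
  then have "energy w - energy z - energy_grad z \<bullet> (w - z) \<le> K * (norm (w - z))\<^sup>2"
    unfolding K_def by (rule energy_divergence_le)
  moreover have "0 \<le> energy w - energy z - energy_grad z \<bullet> (w - z)"
    using energy_divergence_ge[of w z] zero_le_power2[of "norm (w - z)"] by linarith
  ultimately show "norm (energy w - energy z - energy_grad z \<bullet> (w - z)) / norm (w - z) \<le> K * norm (w - z)"
    using w by (simp add: divide_simps power2_eq_square mult_ac)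
qed simp

text \<open>
  Nonlinear maps are rarely weakly continuous; this one is (along sequences), because it acts on
  each coordinate separately by a continuous function and maps bounded sets to bounded sets.
\<close>
lemma energy_grad_weakly_continuous:
  assumes bdd: "bounded (range z)" and coord: "\<And>j. (\<lambda>i. coord (z i) j) \<longlonglongrightarrow> coord l j"
  shows "(\<lambda>i. energy_grad (z i) \<bullet> h) \<longlonglongrightarrow> energy_grad l \<bullet> h"
proof (rule inner_tendsto_of_coordinatewise)
  obtain C where C: "\<And>i. norm (z i) \<le> C"
    using bdd by (auto simp: bounded_iff)
  have "norm (energy_grad (z i)) \<le> 2 * exp (C\<^sup>2) * C" for i
    by (rule order_trans[OF norm_energy_grad_le])
      (intro mult_mono exp_mono power_mono, auto intro: C order_trans[OF norm_ge_zero C])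
  then show "bounded (range (\<lambda>i. energy_grad (z i)))"
    by (auto simp: bounded_iff)
  show "(\<lambda>i. coord (energy_grad (z i)) j) \<longlonglongrightarrow> coord (energy_grad l) j" for j
    unfolding energy_grad.rep_eq by (intro tendsto_intros coord)
qed

section \<open>The change of coordinates\<close>

lemma sums_pairs:
  fixes f :: "nat \<Rightarrow> 'a::real_normed_vector"
  assumes "f sums s"
  shows "(\<lambda>i. f (2 * i) + f (2 * i + 1)) sums s"
  using sums_group[OF assms, of 2] by (simp add: mult.commute add.commute numeral_2_eq_2)

text \<open>
  On each pair of coordinates this is the Hadamard matrix with rows \<open>(1, 1)\<close> and \<open>(1, -1)\<close>, whose
  columns are orthogonal of squared length \<open>2\<close>.
\<close>
lift_definition hadamard :: "ell2 \<Rightarrow> ell2" is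
  "\<lambda>x j. if even j then x j + x (j + 1) else x (j - 1) - x j"
proof -
  fix x :: "nat \<Rightarrow> real"
  assume x: "summable (\<lambda>j. (x j)\<^sup>2)"
  have succ: "summable (\<lambda>j. (x (j + 1))\<^sup>2)"
    using summable_ignore_initial_segment[OF x, of 1] by simp
  \<comment> \<open>At \<open>j = 0\<close> the truncated \<open>j - 1\<close> repeats \<open>x 0\<close>, which only adds one term to the series.\<close>
  have pred: "summable (\<lambda>j. (x (j - 1))\<^sup>2)"
    using x by (subst summable_Suc_iff[symmetric]) simp
  show "summable (\<lambda>j. (if even j then x j + x (j + 1) else x (j - 1) - x j)\<^sup>2)"
  proof (rule summable_comparison_test')
    show "summable (\<lambda>j. (x j + x (j + 1))\<^sup>2 + (x (j - 1) + (- x j))\<^sup>2)"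
      by (intro summable_add square_summable_add) (simp_all add: x succ[simplified] pred[simplified])
  qed auto
qed

lemma coord_hadamard:
  "coord (hadamard x) (2 * i) = coord x (2 * i) + coord x (2 * i + 1)"
  "coord (hadamard x) (2 * i + 1) = coord x (2 * i) - coord x (2 * i + 1)"
  by (simp_all add: hadamard.rep_eq)

lemma norm_hadamard: "(norm (hadamard x))\<^sup>2 = 2 * (norm x)\<^sup>2"
proof (rule sums_unique2)
  show "(\<lambda>i. (coord (hadamard x) (2 * i))\<^sup>2 + (coord (hadamard x) (2 * i + 1))\<^sup>2)
      sums (norm (hadamard x))\<^sup>2"
    by (rule sums_pairs[OF norm_ell2_sums])
  have "(\<lambda>i. 2 * ((coord x (2 * i))\<^sup>2 + (coord x (2 * i + 1))\<^sup>2)) sums (2 * (norm x)\<^sup>2)"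
    by (rule sums_mult[OF sums_pairs[OF norm_ell2_sums]])
  then show "(\<lambda>i. (coord (hadamard x) (2 * i))\<^sup>2 + (coord (hadamard x) (2 * i + 1))\<^sup>2)
      sums (2 * (norm x)\<^sup>2)"
    unfolding coord_hadamard by (simp add: power2_sum power2_diff algebra_simps)
qed

lemma hadamard_bounded_linear: "bounded_linear hadamard"
proof (rule bounded_linear_intro)
  show "hadamard (x + y) = hadamard x + hadamard y" for x y
    by (rule ell2_eqI) (simp add: hadamard.rep_eq coord_simps)
  show "hadamard (r *\<^sub>R x) = r *\<^sub>R hadamard x" for r x
    by (rule ell2_eqI) (simp add: hadamard.rep_eq coord_simps algebra_simps)
  show "norm (hadamard x) \<le> norm x * 2" for x
    by (rule power2_le_imp_le) (simp_all add: norm_hadamard power_mult_distrib)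
qed

lemmas hadamard_diff = bounded_linear.linear[OF hadamard_bounded_linear, THEN linear_diff]

lemma entropy_term_sums: "entropy_term x sums energy (hadamard x)"
  using sums_pairs[OF energy_sums[of "hadamard x"]]
  unfolding entropy_term_def[abs_def] coord_hadamard by (simp add: algebra_simps)

lemma ell2_entropy_eq: "ell2_entropy x = energy (hadamard x)"
  unfolding ell2_entropy_def by (rule sums_unique[OF entropy_term_sums, symmetric])

lemma ell2_entropy_has_derivative:
  "(ell2_entropy has_derivative (\<lambda>h. energy_grad (hadamard y) \<bullet> hadamard h)) (at y)"
  unfolding ell2_entropy_eq[abs_def]
  by (rule has_derivative_compose[OF bounded_linear_imp_has_derivative[OF hadamard_bounded_linear]
        energy_has_derivative])

section \<open>Equivalence of the norms\<close>

lemma norm_ell2_split: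
  "(norm x)\<^sup>2 = (L2_set (coord x) {..<2*n})\<^sup>2 + (sqrt (\<Sum>i. (coord x (2*n + i))\<^sup>2))\<^sup>2"
proof -
  have "(norm x)\<^sup>2 = (\<Sum>i. (coord x (i + 2*n))\<^sup>2) + (\<Sum>i<2*n. (coord x i)\<^sup>2)"
    unfolding sums_unique[OF norm_ell2_sums] by (rule suminf_split_initial_segment[OF summable_coord])
  moreover have "0 \<le> (\<Sum>i. (coord x (2*n + i))\<^sup>2)"
    by (simp add: suminf_nonneg summable_tail)
  ultimately show ?thesis
    by (simp add: L2_set_def sum_nonneg add.commute)
qed

lemma norm_le_ell2_norm: "norm x \<le> ell2_norm n x"
proof (rule power2_le_imp_le)
  define a t where "a = L2_set (coord x) {..<2*n}" and "t = sqrt (\<Sum>i. (coord x (2*n + i))\<^sup>2)"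
  have nonneg: "0 \<le> a" "0 \<le> t"
    by (simp_all add: a_def t_def suminf_nonneg summable_tail)
  have "a \<le> (\<Sum>i<2*n. \<bar>coord x i\<bar>)"
    unfolding a_def by (rule L2_set_le_sum_abs)
  then have le: "a + t \<le> ell2_norm n x"
    by (simp add: ell2_norm_def t_def)
  have "(norm x)\<^sup>2 \<le> (a + t)\<^sup>2"
    using nonneg by (simp add: norm_ell2_split[of x n] power2_sum flip: a_def t_def)
  also have "\<dots> \<le> (ell2_norm n x)\<^sup>2"
    using le nonneg by (intro power_mono) auto
  finally show "(norm x)\<^sup>2 \<le> (ell2_norm n x)\<^sup>2" .
  show "0 \<le> ell2_norm n x"
    using le nonneg by linarith
qed

lemma ell2_norm_nonneg: "0 \<le> ell2_norm n x"
  using norm_le_ell2_norm[of x n] norm_ge_zero[of x] by linarith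

text \<open>
  Cauchy-Schwarz twice: on the \<open>2 n\<close> leading coordinates (factor \<open>c\<^sup>2 = 2 n\<close>), then on the pair made of
  the head norm \<open>a\<close> and the tail norm \<open>t\<close>.
\<close>
lemma ell2_norm_power2_le: "(ell2_norm n x)\<^sup>2 \<le> (2 * real n + 1) * (norm x)\<^sup>2"
proof -
  define a t where "a = L2_set (coord x) {..<2*n}" and "t = sqrt (\<Sum>i. (coord x (2*n + i))\<^sup>2)"
  define c where "c = sqrt (2 * real n)"
  have "(\<Sum>i<2*n. \<bar>coord x i\<bar> * \<bar>1\<bar>) \<le> a * L2_set (\<lambda>_. 1) {..<2*n}"
    unfolding a_def by (rule L2_set_mult_ineq)
  then have "ell2_norm n x \<le> c * a + 1 * t"
    by (simp add: ell2_norm_def L2_set_def t_def c_def mult.commute)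
  then have "(ell2_norm n x)\<^sup>2 \<le> (c * a + 1 * t)\<^sup>2"
    by (intro power_mono ell2_norm_nonneg)
  also have "\<dots> \<le> (c\<^sup>2 + 1) * (a\<^sup>2 + t\<^sup>2)"
  proof -
    have "0 \<le> (a - c * t)\<^sup>2"
      by simp
    then show ?thesis
      by (simp add: power2_eq_square algebra_simps)
  qed
  also have "\<dots> = (2 * real n + 1) * (norm x)\<^sup>2"
    by (simp add: norm_ell2_split[of x n] c_def flip: a_def t_def)
  finally show ?thesis .
qed

lemma ell2_norm_le: "ell2_norm n x \<le> sqrt (2 * real n + 1) * norm x"
  by (rule power2_le_imp_le) (simp_all add: power_mult_distrib ell2_norm_power2_le)

lemma norm_bounded_iff: "norm_bounded (ell2_norm n) S \<longleftrightarrow> bounded S"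
proof
  assume "norm_bounded (ell2_norm n) S"
  then show "bounded S"
    unfolding norm_bounded_def bounded_iff by (meson norm_le_ell2_norm order_trans)
next
  assume "bounded S"
  then obtain C where "\<forall>x\<in>S. norm x \<le> C"
    by (auto simp: bounded_iff)
  then have "\<forall>x\<in>S. ell2_norm n x \<le> sqrt (2 * real n + 1) * C"
    by (intro ballI order_trans[OF ell2_norm_le] mult_left_mono) auto
  then show "norm_bounded (ell2_norm n) S"
    unfolding norm_bounded_def by blast
qed

lemma ell2_norm_tendsto_0_iff: "((\<lambda>i. ell2_norm n (f i)) \<longlongrightarrow> 0) F \<longleftrightarrow> ((\<lambda>i. norm (f i)) \<longlongrightarrow> 0) F"
proof
  assume "((\<lambda>i. ell2_norm n (f i)) \<longlongrightarrow> 0) F"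
  then show "((\<lambda>i. norm (f i)) \<longlongrightarrow> 0) F"
    by (rule tendsto_sandwich[OF _ _ tendsto_const, rotated 2]) (auto simp: norm_le_ell2_norm)
next
  assume "((\<lambda>i. norm (f i)) \<longlongrightarrow> 0) F"
  then have "((\<lambda>i. sqrt (2 * real n + 1) * norm (f i)) \<longlongrightarrow> 0) F"
    by (rule tendsto_mult_right_zero)
  then show "((\<lambda>i. ell2_norm n (f i)) \<longlongrightarrow> 0) F"
    by (rule tendsto_sandwich[OF _ _ tendsto_const, rotated 2])
      (auto simp: ell2_norm_le ell2_norm_nonneg)
qed

lemma norm_tendsto_iff: "norm_tendsto (ell2_norm n) xs x \<longleftrightarrow> xs \<longlonglongrightarrow> x"
  by (simp add: norm_tendsto_def ell2_norm_tendsto_0_iff tendsto_norm_zero_iff LIM_zero_iff)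

lemma bounded_linear_in_dual_space:
  assumes "bounded_linear f"
  shows "f \<in> dual_space (ell2_norm n)"
proof -
  obtain K where K: "K \<ge> 0" "\<And>x. norm (f x) \<le> norm x * K"
    using bounded_linear.nonneg_bounded[OF assms] by blast
  have "\<bar>f x\<bar> \<le> K * ell2_norm n x" for x
    using K(2)[of x] mult_left_mono[OF norm_le_ell2_norm[of x n] K(1)] by (simp add: mult.commute)
  then show ?thesis
    unfolding dual_space_def using assms by (auto dest: bounded_linear.linear)
qed

text \<open>
  Testing on the inner products with fixed vectors gives boundedness, by the uniform boundedness
  principle, and testing on the coordinate functionals gives convergence of the coordinates.
\<close>
lemma weakly_tendsto_imp:
  fixes y :: ell2
  assumes "weakly_tendsto (ell2_norm n) ys y"
  shows "bounded (range ys)" and "(\<lambda>i. coord (ys i) j) \<longlonglongrightarrow> coord y j"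
proof -
  have lim: "(\<lambda>i. f (ys i)) \<longlonglongrightarrow> f y" if "bounded_linear f" for f :: "ell2 \<Rightarrow> real"
    using assms bounded_linear_in_dual_space[OF that] by (auto simp: weakly_tendsto_def)
  have "Bseq (\<lambda>i. ys i \<bullet> h)" for h
    using lim[OF bounded_linear_inner_left] by (blast intro: convergent_imp_Bseq convergentI)
  then show "bounded (range ys)"
    by (rule pointwise_bounded_imp_bounded)
  have "bounded_linear (\<lambda>x. coord x j)"
    by (rule bounded_linear_intro[where K = 1]) (simp_all add: coord_simps abs_coord_le)
  then show "(\<lambda>i. coord (ys i) j) \<longlonglongrightarrow> coord y j"
    by (rule lim)
qed

section \<open>The entropy\<close>

lemma entropy_gateaux:
  "has_gateaux_derivative (ell2_norm n) ell2_entropy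
     (\<lambda>h. energy_grad (hadamard y) \<bullet> hadamard h) y"
  unfolding has_gateaux_derivative_def
proof (intro conjI allI)
  show "(\<lambda>h. energy_grad (hadamard y) \<bullet> hadamard h) \<in> dual_space (ell2_norm n)"
    by (rule bounded_linear_in_dual_space, rule has_derivative_bounded_linear,
        rule ell2_entropy_has_derivative)
  fix h
  have line: "((\<lambda>t. y + t *\<^sub>R h) has_derivative (\<lambda>t. t *\<^sub>R h)) (at 0)"
    by (auto intro!: derivative_eq_intros)
  have "((\<lambda>t. ell2_entropy (y + t *\<^sub>R h)) has_derivative
      (\<lambda>t. energy_grad (hadamard y) \<bullet> hadamard (t *\<^sub>R h))) (at 0)"
    by (rule has_derivative_compose[OF line]) (simp add: ell2_entropy_has_derivative)
  moreover have "(\<lambda>t. energy_grad (hadamard y) \<bullet> hadamard (t *\<^sub>R h))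
      = (*) (energy_grad (hadamard y) \<bullet> hadamard h)"
    by (simp add: linear_cmul[OF bounded_linear.linear[OF hadamard_bounded_linear]] fun_eq_iff)
  ultimately show "((\<lambda>t. ell2_entropy (y + t *\<^sub>R h)) has_real_derivative
      energy_grad (hadamard y) \<bullet> hadamard h) (at 0)"
    by (simp add: has_field_derivative_def)
qed

abbreviation entropy_div :: "nat \<Rightarrow> ell2 \<Rightarrow> ell2 \<Rightarrow> real" where
  "entropy_div n \<equiv> bregman_div (ell2_norm n) ell2_entropy"

lemma entropy_gateaux_derivative:
  "gateaux_derivative (ell2_norm n) ell2_entropy y = (\<lambda>h. energy_grad (hadamard y) \<bullet> hadamard h)"
  unfolding gateaux_derivative_def
  by (rule the_equality) (auto intro: entropy_gateaux has_gateaux_derivative_unique)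

lemma entropy_div_eq:
  "entropy_div n x y = energy (hadamard x) - energy (hadamard y)
     - energy_grad (hadamard y) \<bullet> (hadamard x - hadamard y)"
  by (simp add: bregman_div_def entropy_gateaux_derivative ell2_entropy_eq hadamard_diff)

lemma entropy_div_ge: "2 * (norm (x - y))\<^sup>2 \<le> entropy_div n x y"
  using energy_divergence_ge[of "hadamard x" "hadamard y"]
  by (simp add: entropy_div_eq norm_hadamard flip: hadamard_diff)

lemma entropy_div_tendsto_0:
  assumes "ys \<longlonglongrightarrow> x"
  shows "(\<lambda>i. entropy_div n x (ys i)) \<longlonglongrightarrow> 0"
proof -
  have "bounded (insert x (range ys))"
    using convergent_imp_bounded[OF assms] by simp
  from bounded_linear_image[OF this hadamard_bounded_linear]
  obtain M where M: "norm (hadamard x) \<le> M" "\<And>i. norm (hadamard (ys i)) \<le> M"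
    by (auto simp: bounded_iff)
  define K where "K = (1 + 2 * M\<^sup>2) * exp (M\<^sup>2)"
  show ?thesis
  proof (rule tendsto_sandwich)
    have "0 \<le> entropy_div n x (ys i)" for i
      using entropy_div_ge[of x "ys i" n] zero_le_power2[of "norm (x - ys i)"] by linarith
    then show "\<forall>\<^sub>F i in sequentially. 0 \<le> entropy_div n x (ys i)"
      by simp
    have "entropy_div n x (ys i) \<le> K * (norm (hadamard x - hadamard (ys i)))\<^sup>2" for i
      unfolding entropy_div_eq K_def by (intro energy_divergence_le M)
    then show "\<forall>\<^sub>F i in sequentially. entropy_div n x (ys i) \<le> K * (norm (hadamard x - hadamard (ys i)))\<^sup>2"
      by simp
    have "(\<lambda>i. K * (norm (hadamard x - hadamard (ys i)))\<^sup>2)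
        \<longlonglongrightarrow> K * (norm (hadamard x - hadamard x))\<^sup>2"
      by (intro tendsto_intros bounded_linear.tendsto[OF hadamard_bounded_linear] assms)
    then show "(\<lambda>i. K * (norm (hadamard x - hadamard (ys i)))\<^sup>2) \<longlonglongrightarrow> 0"
      by simp
  qed simp
qed

lemma entropy_div_tendsto_0_imp:
  assumes "(\<lambda>i. entropy_div n (xs i) (ys i)) \<longlonglongrightarrow> 0"
  shows "(\<lambda>i. norm (xs i - ys i)) \<longlonglongrightarrow> 0"
proof -
  have "(\<lambda>i. (norm (xs i - ys i))\<^sup>2) \<longlonglongrightarrow> 0"
  proof (rule tendsto_sandwich[OF _ _ tendsto_const assms])
    have "(norm (xs i - ys i))\<^sup>2 \<le> entropy_div n (xs i) (ys i)" for i
      using entropy_div_ge[of "xs i" "ys i" n] zero_le_power2[of "norm (xs i - ys i)"] by linarith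
    then show "\<forall>\<^sub>F i in sequentially. (norm (xs i - ys i))\<^sup>2 \<le> entropy_div n (xs i) (ys i)"
      by simp
  qed simp
  then show ?thesis
    using tendsto_real_sqrt by fastforce
qed

lemma norm_le_of_entropy_div_le:
  assumes "entropy_div n x y \<le> \<gamma>"
  shows "norm (x - y) \<le> sqrt (\<gamma> / 2)"
  using assms entropy_div_ge[of x y n] by (intro real_le_rsqrt) simp

text \<open>
  Both endpoints are compared with the tangent plane at the intermediate point \<open>z\<close> by
  \<open>entropy_div_ge\<close>. In the combination with weights \<open>t\<close> and \<open>1 - t\<close> the linear terms cancel, and
  \<open>t (1 - t)\<^sup>2 + (1 - t) t\<^sup>2 = t (1 - t)\<close>.
\<close>
lemma entropy_uniformly_convex:
  assumes "0 < t" "t < 1"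
  shows "ell2_entropy (t *\<^sub>R x + (1 - t) *\<^sub>R y) + 2 * t * (1 - t) * (norm (x - y))\<^sup>2
    \<le> t * ell2_entropy x + (1 - t) * ell2_entropy y"
proof -
  define z where "z = t *\<^sub>R x + (1 - t) *\<^sub>R y"
  define g where "g h = energy_grad (hadamard z) \<bullet> hadamard h" for h
  have g: "bounded_linear g"
    unfolding g_def by (rule has_derivative_bounded_linear[OF ell2_entropy_has_derivative])
  \<comment> \<open>The divergence is the same for all the norms, which enter only through the dual space.\<close>
  have div: "entropy_div 0 w z = ell2_entropy w - ell2_entropy z - g (w - z)" for w
    by (simp add: bregman_div_def entropy_gateaux_derivative g_def)
  have xz: "x - z = (1 - t) *\<^sub>R (x - y)" and yz: "y - z = (- t) *\<^sub>R (x - y)"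
    by (simp_all add: z_def algebra_simps)
  have "2 * ((1 - t)\<^sup>2 * (norm (x - y))\<^sup>2) \<le> ell2_entropy x - ell2_entropy z - (1 - t) * g (x - y)"
    using entropy_div_ge[of x z 0] unfolding div xz
    by (simp add: power_mult_distrib linear_cmul[OF bounded_linear.linear[OF g]])
  moreover have "2 * (t\<^sup>2 * (norm (x - y))\<^sup>2) \<le> ell2_entropy y - ell2_entropy z + t * g (x - y)"
    using entropy_div_ge[of y z 0] unfolding div yz
    by (simp add: power_mult_distrib linear_cmul[OF bounded_linear.linear[OF g]]
        linear_neg[OF bounded_linear.linear[OF g]])
  ultimately have "t * (2 * ((1 - t)\<^sup>2 * (norm (x - y))\<^sup>2)) + (1 - t) * (2 * (t\<^sup>2 * (norm (x - y))\<^sup>2))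
     \<le> t * (ell2_entropy x - ell2_entropy z - (1 - t) * g (x - y))
       + (1 - t) * (ell2_entropy y - ell2_entropy z + t * g (x - y))"
    using assms by (intro add_mono mult_left_mono) auto
  then show ?thesis
    unfolding z_def[symmetric] by (simp add: algebra_simps power2_eq_square)
qed

lemma entropy_bregman_function: "bregman_function (ell2_norm n) ell2_entropy"
  unfolding bregman_function_def norm_bounded_iff norm_tendsto_iff
proof (intro conjI allI impI)
  show "gateaux_differentiable (ell2_norm n) ell2_entropy"
    unfolding gateaux_differentiable_def using entropy_gateaux by blast
  show "strictly_convex ell2_entropy"
    unfolding strictly_convex_def
  proof (intro allI ballI impI)
    fix x y :: ell2 and t :: real
    assume t: "t \<in> {0<..<1}" and "x \<noteq> y"
    then have "0 < 2 * t * (1 - t) * (norm (x - y))\<^sup>2"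
      by (intro mult_pos_pos) auto
    with t show "ell2_entropy (t *\<^sub>R x + (1 - t) *\<^sub>R y) < t * ell2_entropy x + (1 - t) * ell2_entropy y"
      using entropy_uniformly_convex[of t x y] by simp
  qed
  show "lower_semicont (ell2_norm n) ell2_entropy"
    unfolding lower_semicont_def
  proof (intro allI impI)
    fix x :: ell2 and \<epsilon> :: real
    assume "\<epsilon> > 0"
    have "isCont ell2_entropy x"
      by (rule has_derivative_continuous[OF ell2_entropy_has_derivative])
    then obtain \<delta> where "\<delta> > 0" and \<delta>: "\<And>y. dist y x < \<delta> \<Longrightarrow> dist (ell2_entropy y) (ell2_entropy x) < \<epsilon>"
      using \<open>\<epsilon> > 0\<close> unfolding continuous_at_eps_delta by metis
    have "ell2_entropy x - \<epsilon> < ell2_entropy y" if "ell2_norm n (y - x) < \<delta>" for y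
      using \<delta>[of y] norm_le_ell2_norm[of "y - x" n] that by (simp add: dist_norm abs_less_iff)
    with \<open>\<delta> > 0\<close> show "\<exists>\<delta>>0. \<forall>y. ell2_norm n (y - x) < \<delta> \<longrightarrow> ell2_entropy x - \<epsilon> < ell2_entropy y"
      by blast
  qed
  show "bounded {y. entropy_div n x y \<le> \<gamma>}" for \<gamma> x
    by (rule bounded_subset[OF bounded_cball[of x "sqrt (\<gamma> / 2)"]])
      (auto simp: dist_norm dest: norm_le_of_entropy_div_le)
  show "(\<lambda>i. entropy_div n x (ys i)) \<longlonglongrightarrow> 0" if "ys \<longlonglongrightarrow> x" for x ys
    using that by (rule entropy_div_tendsto_0)
  fix xs ys :: "nat \<Rightarrow> ell2" and y
  assume "bounded (range xs) \<and> (\<lambda>i. entropy_div n (xs i) (ys i)) \<longlonglongrightarrow> 0 \<and> ys \<longlonglongrightarrow> y"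
  then have "(\<lambda>i. xs i - ys i) \<longlonglongrightarrow> 0" "ys \<longlonglongrightarrow> y"
    using entropy_div_tendsto_0_imp by (blast intro: tendsto_norm_zero_cancel)+
  from tendsto_add[OF this] show "xs \<longlonglongrightarrow> y"
    by simp
qed

text \<open>
  The values \<open>b y\<^sub>i\<close>, which need not converge, cancel in the difference of the two divergences.
\<close>
lemma entropy_limiting_difference: "limiting_difference (ell2_norm n) ell2_entropy"
  unfolding limiting_difference_def
proof (intro allI impI)
  fix x y :: ell2 and ys
  assume "weakly_tendsto (ell2_norm n) ys y"
  note ys = weakly_tendsto_imp[OF this]
  have "bounded (range (\<lambda>i. hadamard (ys i)))"
    using bounded_linear_image[OF ys(1) hadamard_bounded_linear] by (simp add: image_image)
  moreover have "(\<lambda>i. coord (hadamard (ys i)) j) \<longlonglongrightarrow> coord (hadamard y) j" for j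
    unfolding hadamard.rep_eq by (auto intro!: tendsto_intros ys(2))
  ultimately have "(\<lambda>i. energy_grad (hadamard (ys i)) \<bullet> hadamard (x - y))
      \<longlonglongrightarrow> energy_grad (hadamard y) \<bullet> hadamard (x - y)"
    by (rule energy_grad_weakly_continuous)
  then have "(\<lambda>i. ell2_entropy x - ell2_entropy y - energy_grad (hadamard (ys i)) \<bullet> hadamard (x - y))
      \<longlonglongrightarrow> entropy_div n x y"
    unfolding bregman_div_def entropy_gateaux_derivative by (intro tendsto_diff tendsto_const)
  moreover have "entropy_div n x (ys i) - entropy_div n y (ys i)
      = ell2_entropy x - ell2_entropy y - energy_grad (hadamard (ys i)) \<bullet> hadamard (x - y)" for i
    by (simp add: bregman_div_def entropy_gateaux_derivative hadamard_diff inner_diff_right)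
  ultimately show "(\<lambda>i. entropy_div n x (ys i) - entropy_div n y (ys i)) \<longlonglongrightarrow> entropy_div n x y"
    by simp
qed

text \<open>
  The factor \<open>2\<close> in \<open>entropy_uniformly_convex\<close> has to dominate \<open>\<mu> (2 n + 1) / 2\<close>.
\<close>
lemma entropy_strongly_convex:
  "strongly_convex (ell2_norm n) ell2_entropy (if n > 0 then 1 / real n else 4)"
    (is "strongly_convex _ _ ?\<mu>")
  unfolding strongly_convex_def
proof (intro conjI allI ballI)
  have convex: "ell2_entropy (t *\<^sub>R x + (1 - t) *\<^sub>R y) \<le> t * ell2_entropy x + (1 - t) * ell2_entropy y"
    if "0 < t" "t < 1" for t x y
  proof -
    have "0 \<le> 2 * t * (1 - t) * (norm (x - y))\<^sup>2"
      using that by simp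
    then show ?thesis
      using entropy_uniformly_convex[OF that, of x y] by linarith
  qed
  show "convex_on UNIV ell2_entropy"
  proof (rule convex_onI)
    fix t :: real and x y
    assume "0 < t" "t < 1"
    then show "ell2_entropy ((1 - t) *\<^sub>R x + t *\<^sub>R y) \<le> (1 - t) * ell2_entropy x + t * ell2_entropy y"
      using convex[of "1 - t" x y] by simp
  qed simp
  show "?\<mu> > 0"
    by simp
  fix x y :: ell2 and t :: real
  assume t: "t \<in> {0<..<1}"
  have \<mu>: "0 \<le> ?\<mu>" "?\<mu> * (2 * real n + 1) \<le> 4"
    by (auto simp: field_simps)
  have "?\<mu> * (ell2_norm n (x - y))\<^sup>2 \<le> ?\<mu> * ((2 * real n + 1) * (norm (x - y))\<^sup>2)"
    using \<mu>(1) by (intro mult_left_mono ell2_norm_power2_le)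
  also have "\<dots> = ?\<mu> * (2 * real n + 1) * (norm (x - y))\<^sup>2"
    by (simp only: mult.assoc)
  also have "\<dots> \<le> 4 * (norm (x - y))\<^sup>2"
    using \<mu>(2) by (intro mult_right_mono) auto
  finally have "1/2 * t * (1 - t) * (?\<mu> * (ell2_norm n (x - y))\<^sup>2)
      \<le> 1/2 * t * (1 - t) * (4 * (norm (x - y))\<^sup>2)"
    using t by (intro mult_left_mono) auto
  also have "1/2 * t * (1 - t) * (?\<mu> * (ell2_norm n (x - y))\<^sup>2)
      = 1/2 * ?\<mu> * t * (1 - t) * (ell2_norm n (x - y))\<^sup>2"
    by (simp only: mult_ac)
  also have "1/2 * t * (1 - t) * (4 * (norm (x - y))\<^sup>2) = 2 * t * (1 - t) * (norm (x - y))\<^sup>2"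
    by simp
  finally have "ell2_entropy (t *\<^sub>R x + (1 - t) *\<^sub>R y) + 1/2 * ?\<mu> * t * (1 - t) * (ell2_norm n (x - y))\<^sup>2
      \<le> ell2_entropy (t *\<^sub>R x + (1 - t) *\<^sub>R y) + 2 * t * (1 - t) * (norm (x - y))\<^sup>2"
    by (rule add_left_mono)
  also have "\<dots> \<le> t * ell2_entropy x + (1 - t) * ell2_entropy y"
    using t by (intro entropy_uniformly_convex) auto
  finally show "ell2_entropy (t *\<^sub>R x + (1 - t) *\<^sub>R y) + 1/2 * ?\<mu> * t * (1 - t) * (ell2_norm n (x - y))\<^sup>2
      \<le> t * ell2_entropy x + (1 - t) * ell2_entropy y" .
qed

theorem mainTheorem12:
  fixes n :: nat
  shows "(\<forall>x. summable (entropy_term x)) \<and>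
    bregman_function (ell2_norm n) ell2_entropy \<and>
    sequentially_consistent (ell2_norm n) ell2_entropy \<and>
    limiting_difference (ell2_norm n) ell2_entropy \<and>
    (\<forall>y \<gamma>. norm_bounded (ell2_norm n) {x. bregman_div (ell2_norm n) ell2_entropy x y \<le> \<gamma>}) \<and>
    strongly_convex (ell2_norm n) ell2_entropy (if n > 0 then 1 / real n else 4)"
proof (intro conjI allI)
  show "summable (entropy_term x)" for x
    using entropy_term_sums by (rule sums_summable)
  show "bregman_function (ell2_norm n) ell2_entropy"
    by (rule entropy_bregman_function)
  show "sequentially_consistent (ell2_norm n) ell2_entropy"
    unfolding sequentially_consistent_def ell2_norm_tendsto_0_iff
    using entropy_div_tendsto_0_imp by blast
  show "limiting_difference (ell2_norm n) ell2_entropy"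
    by (rule entropy_limiting_difference)
  show "norm_bounded (ell2_norm n) {x. entropy_div n x y \<le> \<gamma>}" for y \<gamma>
    unfolding norm_bounded_iff
    by (rule bounded_subset[OF bounded_cball[of y "sqrt (\<gamma> / 2)"]])
      (auto simp: dist_norm norm_minus_commute dest: norm_le_of_entropy_div_le)
  show "strongly_convex (ell2_norm n) ell2_entropy (if n > 0 then 1 / real n else 4)"
    by (rule entropy_strongly_convex)
qed

end
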